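(* Let $\alpha\in(0,1)$. There is a constant $c$, independent of $h$, such that the following hold. (i) Let $h\in C_T\mathcal C^{\alpha+1}$. Then the function $t\mapsto\int_t^TP_{s-t}h(s)\,ds$ belongs to $C_T\mathcal C^{\alpha+1}$ and $$\Big\|\int_\cdot^TP_{s-\cdot}h(s)\,ds\Big\|_{C_T\mathcal C^{\alpha+1}}\le c\,\|h\|_{C_T\mathcal C^{\alpha+1}}.$$ (ii) Let $h\in C_TD\mathcal C^{\alpha}$. Then the function $t\mapsto\int_t^TP_{s-t}h(s)\,ds$ belongs to $C_TD\mathcal C^{\alpha}$ and $$\Big\|\int_\cdot^TP_{s-\cdot}h(s)\,ds\Big\|_{C_TD\mathcal C^{\alpha}}\le c\,\|h\|_{C_TD\mathcal C^{\alpha}}.$$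
   Context: Fix $d\ge1$, $T>0$ (constants may depend on them). For $\gamma\in\mathbb R$, $\mathcal C^\gamma=\mathcal C^\gamma(\mathbb R^d)$ is the Besov (Hölder–Zygmund) space $B^\gamma_{\infty,\infty}$, with norm $\|\cdot\|_\gamma$; for $\gamma>0$ non-integer it is the classical Hölder space of bounded functions. For $\alpha\in(0,1)$, $D\mathcal C^\alpha$ is the space of differentiable $h:\mathbb R^d\to\mathbb R$ with $\nabla h\in\mathcal C^\alpha$, with norm $\|h\|_{D\mathcal C^\alpha}=|h(0)|+\|\nabla h\|_\alpha$. $C_TX:=C([0,T];X)$ with norm $\sup_{t\in[0,T]}\|f(t)\|_X$. $P_t$ is the heat semigroup generated by $\tfrac12\Delta$, i.e. convolution with $p_t(x)=(2\pi t)^{-d/2}e^{-|x|^2/(2t)}$ for $t>0$, $P_0=\mathrm{Id}$. *)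

theory Defs
  imports "HOL-Analysis.Analysis"
begin

text \<open>
  For non-integer \<open>\<gamma> > 0\<close> the Besov space \<open>B\<^sup>\<gamma>\<close> with both indices infinite is the classical Hoelder
  space of bounded functions, and this is how it is defined here.  With \<open>\<gamma> = k + \<theta>\<close>, \<open>k\<close> a natural
  number and \<open>0 < \<theta> < 1\<close>, its elements are the \<open>k\<close> times differentiable functions which are
  bounded together with all their partial derivatives up to order \<open>k\<close>, those of order \<open>k\<close> being
  \<open>\<theta>\<close>-Hoelder continuous.  The codomain is a normed space so that gradients are covered.
\<close>

primrec is_holder ::
    "nat \<Rightarrow> real \<Rightarrow> ('a::euclidean_space \<Rightarrow> 'b::real_normed_vector) \<Rightarrow> bool" where
  "is_holder 0 \<theta> f \<longleftrightarrow>
     bounded (range f) \<and> (\<exists>C. \<forall>x y. dist (f x) (f y) \<le> C * dist x y powr \<theta>)"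
| "is_holder (Suc k) \<theta> f \<longleftrightarrow>
     bounded (range f) \<and> (\<forall>x. f differentiable (at x)) \<and>
     (\<forall>i\<in>Basis. is_holder k \<theta> (\<lambda>x. frechet_derivative f (at x) i))"

definition sup_norm :: "('a \<Rightarrow> 'b::real_normed_vector) \<Rightarrow> real" where
  "sup_norm f = (SUP x. norm (f x))"

definition holder_seminorm ::
    "real \<Rightarrow> ('a::euclidean_space \<Rightarrow> 'b::real_normed_vector) \<Rightarrow> real" where
  "holder_seminorm \<theta> f =
     (SUP (x, y) \<in> {(x, y). x \<noteq> y}. dist (f x) (f y) / dist x y powr \<theta>)"

primrec holder_norm_aux ::
    "nat \<Rightarrow> real \<Rightarrow> ('a::euclidean_space \<Rightarrow> 'b::real_normed_vector) \<Rightarrow> real" where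
  "holder_norm_aux 0 \<theta> f = sup_norm f + holder_seminorm \<theta> f"
| "holder_norm_aux (Suc k) \<theta> f =
     sup_norm f + (\<Sum>i\<in>Basis. holder_norm_aux k \<theta> (\<lambda>x. frechet_derivative f (at x) i))"

text \<open>
  The following two are meant for \<open>\<gamma> > 0\<close> not an integer; \<open>holder_norm\<close> uses suprema of reals and is
  meaningful on \<open>holder_space\<close> only.
\<close>

definition holder_space ::
    "real \<Rightarrow> ('a::euclidean_space \<Rightarrow> 'b::real_normed_vector) set" where
  "holder_space \<gamma> = {f. is_holder (nat \<lfloor>\<gamma>\<rfloor>) (frac \<gamma>) f}"

definition holder_norm ::
    "real \<Rightarrow> ('a::euclidean_space \<Rightarrow> 'b::real_normed_vector) \<Rightarrow> real" where
  "holder_norm \<gamma> f = holder_norm_aux (nat \<lfloor>\<gamma>\<rfloor>) (frac \<gamma>) f"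

definition gradient :: "('a::euclidean_space \<Rightarrow> real) \<Rightarrow> 'a \<Rightarrow> 'a" where
  "gradient f x = (\<Sum>i\<in>Basis. frechet_derivative f (at x) i *\<^sub>R i)"

definition D_holder_space :: "real \<Rightarrow> ('a::euclidean_space \<Rightarrow> real) set" where
  "D_holder_space \<alpha> = {h. (\<forall>x. h differentiable (at x)) \<and> gradient h \<in> holder_space \<alpha>}"

definition D_holder_norm :: "real \<Rightarrow> ('a::euclidean_space \<Rightarrow> real) \<Rightarrow> real" where
  "D_holder_norm \<alpha> h = \<bar>h 0\<bar> + holder_norm \<alpha> (gradient h)"

text \<open>
  \<open>C([0,T]; X)\<close> for a space \<open>X\<close> of functions normed by \<open>N\<close>.  Elements are represented by functions on
  all of \<^typ>\<open>real\<close>, of which only the values on \<open>[0,T]\<close> matter.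
\<close>

definition CT :: "real \<Rightarrow> ('a \<Rightarrow> real) set \<Rightarrow> (('a \<Rightarrow> real) \<Rightarrow> real) \<Rightarrow> (real \<Rightarrow> 'a \<Rightarrow> real) set" where
  "CT T X N = {f. (\<forall>t\<in>{0..T}. f t \<in> X) \<and>
     (\<forall>t\<in>{0..T}. ((\<lambda>s. N (\<lambda>x. f s x - f t x)) \<longlongrightarrow> 0) (at t within {0..T}))}"

definition CT_norm :: "real \<Rightarrow> (('a \<Rightarrow> real) \<Rightarrow> real) \<Rightarrow> (real \<Rightarrow> 'a \<Rightarrow> real) \<Rightarrow> real" where
  "CT_norm T N f = (SUP t\<in>{0..T}. N (f t))"

definition heat_kernel :: "real \<Rightarrow> 'a::euclidean_space \<Rightarrow> real" where
  "heat_kernel t x = (2 * pi * t) powr (- real DIM('a) / 2) * exp (- (norm x)\<^sup>2 / (2 * t))"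

definition heat_semigroup ::
    "real \<Rightarrow> ('a::euclidean_space \<Rightarrow> real) \<Rightarrow> 'a \<Rightarrow> real" where
  "heat_semigroup t f x =
     (if t = 0 then f x else (LINT y|lborel. heat_kernel t (x - y) * f y))"

definition heat_potential ::
    "real \<Rightarrow> (real \<Rightarrow> 'a::euclidean_space \<Rightarrow> real) \<Rightarrow> real \<Rightarrow> 'a \<Rightarrow> real" where
  "heat_potential T h t x = (LINT s:{t..T}|lborel. heat_semigroup (s - t) (h s) x)"

end

theory Submission
  imports Defs "HOL-Probability.Distributions"
begin

text \<open>
  Averaging against a Gaussian is a contraction for the sup norm and for every Hoelder seminorm, and it
  commutes with the gradient; hence integrating over a time interval costs a factor \<open>T\<close> at most.  After the substitution
  \<open>r = s - t\<close> the potential is a single average over time and space,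
  \<open>F t x = \<integral> h (t + r) (x - y) d\<mu>(r, y)\<close>, where \<open>\<mu>\<close> has density \<open>p\<^sub>r(y)\<close> on \<open>0 < r \<le> T - t\<close> and total mass
  \<open>T - t\<close>.  Differentiating under the integral sign bounds \<open>\<nabla>(F t)\<close> and its Hoelder constant by \<open>T\<close> times
  those of \<open>h\<close>.
  
  The two spaces differ only in the points at which the function itself is controlled: everywhere for
  the first, at the origin for the second.  Both are covered by the predicate \<open>C1_holder_le \<alpha> A B f\<close>,
  in which \<open>A\<close> is the set of these points; up to a constant factor each of the two norms is the least
  such \<open>B\<close>.  The value of \<open>F t\<close> at \<open>x \<in> A\<close> involves values of \<open>h s\<close> at \<open>x - y\<close>, which need not lie in
  \<open>A\<close>; the mean value theorem gives \<open>\<bar>h s (x - y)\<bar> \<le> B + B \<bar>y\<bar>\<close>, and the first moment of \<open>p\<^sub>r\<close> is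
  at most a multiple of \<open>\<surd>r\<close>.  The resulting estimate is \<open>C1_holder_le_heat_average\<close>.
  
  Continuity in time follows from the same estimate.  For \<open>s \<le> t\<close>, the difference \<open>F s - F t\<close> is the average of
  \<open>h (s + r) - h (t + r)\<close> over \<open>0 < r \<le> T - t\<close> plus the average of \<open>h (s + r)\<close> over the short interval
  \<open>T - t < r \<le> T - s\<close>.  The first is small because \<open>h\<close>, being continuous on the compact interval
  \<open>[0, T]\<close>, is uniformly continuous; the second because the mass of the interval is \<open>t - s\<close>.
\<close>

section \<open>Gradients and differentiation under the integral sign\<close>

lemma has_derivative_gradient:
  assumes "f differentiable (at x)"
  shows "(f has_derivative (\<lambda>v. gradient f x \<bullet> v)) (at x)"
proof -
  let ?D = "frechet_derivative f (at x)"
  have D: "(f has_derivative ?D) (at x)"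
    using assms by (simp add: frechet_derivative_works)
  then have lin: "linear ?D" by (rule has_derivative_linear)
  have "?D v = gradient f x \<bullet> v" for v
  proof -
    have "?D v = ?D (\<Sum>i\<in>Basis. (v \<bullet> i) *\<^sub>R i)" by (simp add: euclidean_representation)
    also have "\<dots> = (\<Sum>i\<in>Basis. (v \<bullet> i) * ?D i)"
      by (simp add: linear_sum[OF lin] linear_cmul[OF lin])
    also have "\<dots> = gradient f x \<bullet> v"
      by (simp add: gradient_def inner_sum_left inner_sum_right inner_commute mult.commute)
    finally show ?thesis .
  qed
  then have "?D = (\<lambda>v. gradient f x \<bullet> v)" by auto
  with D show ?thesis by simp
qed

lemma gradient_eqI:
  assumes "(f has_derivative (\<lambda>v. g \<bullet> v)) (at x)"
  shows "gradient f x = g"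
  using frechet_derivative_at[OF assms, symmetric]
  by (simp add: gradient_def euclidean_representation)

lemma frechet_derivative_eq_gradient:
  assumes "f differentiable (at x)"
  shows "frechet_derivative f (at x) v = gradient f x \<bullet> v"
  using frechet_derivative_at[OF has_derivative_gradient[OF assms]] by metis

lemma gradient_diff:
  assumes "f differentiable (at x)" "g differentiable (at x)"
  shows "gradient (\<lambda>x. f x - g x) x = gradient f x - gradient g x"
  using has_derivative_diff[OF assms[THEN has_derivative_gradient]]
  by (intro gradient_eqI) (simp add: inner_diff_left)

lemma dist_le_of_gradient_le:
  fixes f :: "'a::euclidean_space \<Rightarrow> real"
  assumes "\<And>x. f differentiable (at x)" "\<And>x. norm (gradient f x) \<le> B"
  shows "\<bar>f x - f y\<bar> \<le> B * norm (x - y)"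
proof -
  have "norm (f x - f y) \<le> B * norm (x - y)"
  proof (rule differentiable_bound[OF convex_UNIV])
    show "(f has_derivative (\<lambda>v. gradient f x \<bullet> v)) (at x within UNIV)" for x
      using has_derivative_gradient[OF assms(1)] by simp
    show "onorm (\<lambda>v. gradient f x \<bullet> v) \<le> B" for x
    proof (rule onorm_le)
      fix v
      have "norm (gradient f x \<bullet> v) \<le> norm (gradient f x) * norm v"
        by (simp add: Cauchy_Schwarz_ineq2)
      also have "\<dots> \<le> B * norm v" by (intro mult_right_mono assms) auto
      finally show "norm (gradient f x \<bullet> v) \<le> B * norm v" .
    qed
  qed auto
  then show ?thesis by simp
qed

text \<open>
  By the mean value theorem a bound on the gradient that does not depend on the point dominates all
  difference quotients at once, so the dominated convergence theorem applies along every sequence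
  tending to the point.
\<close>

lemma has_derivative_integral_gradient:
  fixes f :: "'c \<Rightarrow> 'a::euclidean_space \<Rightarrow> real" and G :: "'c \<Rightarrow> 'a \<Rightarrow> 'a"
  assumes f: "\<And>x. integrable M (\<lambda>\<omega>. f \<omega> x)"
    and G: "(\<lambda>\<omega>. G \<omega> x) \<in> borel_measurable M"
    and deriv: "\<And>\<omega> x. (f \<omega> has_derivative (\<lambda>v. G \<omega> x \<bullet> v)) (at x)"
    and w: "integrable M w" "\<And>\<omega> x. norm (G \<omega> x) \<le> w \<omega>"
  shows "((\<lambda>x. \<integral>\<omega>. f \<omega> x \<partial>M) has_derivative (\<lambda>v. (\<integral>\<omega>. G \<omega> x \<partial>M) \<bullet> v)) (at x)"
  unfolding has_derivative_at
proof (intro conjI)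
  show "bounded_linear (\<lambda>v. (\<integral>\<omega>. G \<omega> x \<partial>M) \<bullet> v)" by (rule bounded_linear_inner_right)
  have intG: "integrable M (\<lambda>\<omega>. G \<omega> x)"
    by (rule Bochner_Integration.integrable_bound[OF w(1) G]) (auto intro!: AE_I2 order_trans[OF w(2)])
  \<comment> \<open>\<open>q h\<close> is the normalised remainder of the first order expansion; \<open>2 * w\<close> dominates it.\<close>
  define q where "q h \<omega> = (f \<omega> (x + h) - f \<omega> x - G \<omega> x \<bullet> h) / norm h" for h \<omega>
  have intq: "integrable M (q h)" for h
    unfolding q_def by (intro integrable_divide Bochner_Integration.integrable_diff f
        integrable_inner_left intG)
  have q_eq: "(\<integral>\<omega>. q h \<omega> \<partial>M)
      = ((\<integral>\<omega>. f \<omega> (x + h) \<partial>M) - (\<integral>\<omega>. f \<omega> x \<partial>M) - (\<integral>\<omega>. G \<omega> x \<partial>M) \<bullet> h) / norm h" for h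
    unfolding q_def using f intG
    by (cases "h = 0") (simp_all add: integral_inner_left)
  have q_bound: "norm (q h \<omega>) \<le> 2 * w \<omega>" for h \<omega>
  proof (cases "h = 0")
    case False
    have df: "f \<omega> differentiable (at y)" for y using deriv differentiableI by blast
    have "\<bar>f \<omega> (x + h) - f \<omega> x\<bar> \<le> w \<omega> * norm h"
      using dist_le_of_gradient_le[of "f \<omega>" "w \<omega>" "x + h" x] df w(2)
      by (simp add: gradient_eqI[OF deriv])
    moreover have "\<bar>G \<omega> x \<bullet> h\<bar> \<le> w \<omega> * norm h"
      by (rule order_trans[OF Cauchy_Schwarz_ineq2]) (intro mult_right_mono w(2) norm_ge_zero)
    ultimately have "\<bar>f \<omega> (x + h) - f \<omega> x - G \<omega> x \<bullet> h\<bar> \<le> 2 * w \<omega> * norm h" by linarith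
    then show ?thesis using False by (simp add: q_def divide_le_eq)
  next
    case True
    have "0 \<le> w \<omega>" using w(2)[of \<omega> x] norm_ge_zero order_trans by blast
    then show ?thesis using True by (simp add: q_def)
  qed
  have "((\<lambda>h. \<integral>\<omega>. q h \<omega> \<partial>M) \<longlongrightarrow> 0) (at 0)"
    unfolding tendsto_at_iff_sequentially
  proof (intro allI impI)
    fix X :: "nat \<Rightarrow> 'a" assume X: "\<forall>i. X i \<in> UNIV - {0}" "X \<longlonglongrightarrow> 0"
    have lim: "(\<lambda>n. q (X n) \<omega>) \<longlonglongrightarrow> 0" for \<omega>
    proof -
      have "((\<lambda>h. norm (f \<omega> (x + h) - f \<omega> x - G \<omega> x \<bullet> h) / norm h) \<longlongrightarrow> 0) (at 0)"
        using deriv[of \<omega> x] unfolding has_derivative_at by blast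
      then have "(\<lambda>n. norm (f \<omega> (x + X n) - f \<omega> x - G \<omega> x \<bullet> X n) / norm (X n)) \<longlonglongrightarrow> 0"
        using X unfolding tendsto_at_iff_sequentially comp_def by blast
      then have "(\<lambda>n. norm (q (X n) \<omega>)) \<longlonglongrightarrow> 0" by (simp add: q_def)
      then show ?thesis by (rule tendsto_norm_zero_cancel)
    qed
    have "(\<lambda>n. \<integral>\<omega>. q (X n) \<omega> \<partial>M) \<longlonglongrightarrow> (\<integral>\<omega>. 0 \<partial>M)"
      by (rule integral_dominated_convergence[where w = "\<lambda>\<omega>. 2 * w \<omega>"])
        (use w(1) intq lim q_bound in auto)
    then show "((\<lambda>h. \<integral>\<omega>. q h \<omega> \<partial>M) \<circ> X) \<longlonglongrightarrow> 0" by (simp add: comp_def)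
  qed
  then have "((\<lambda>h. norm (\<integral>\<omega>. q h \<omega> \<partial>M)) \<longlongrightarrow> 0) (at 0)" by (rule tendsto_norm_zero)
  then show "((\<lambda>h. norm ((\<integral>\<omega>. f \<omega> (x + h) \<partial>M) - (\<integral>\<omega>. f \<omega> x \<partial>M)
      - (\<integral>\<omega>. G \<omega> x \<partial>M) \<bullet> h) / norm h) \<longlongrightarrow> 0) (at 0)"
    by (simp add: q_eq)
qed

section \<open>A common gauge for both spaces\<close>

text \<open>
  Taking \<open>A = UNIV\<close> gives bounded functions with a bounded Hoelder gradient; for \<open>A = {0}\<close> the functions
  may grow linearly.  A bound \<open>B\<close> is used in place of a norm because it is additive and monotone by
  inspection, whereas a supremum of reals says nothing until it is known to be finite.
\<close>

definition C1_holder_le ::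
    "real \<Rightarrow> 'a::euclidean_space set \<Rightarrow> real \<Rightarrow> ('a \<Rightarrow> real) \<Rightarrow> bool" where
  "C1_holder_le \<alpha> A B f \<longleftrightarrow>
     (\<forall>x. f differentiable (at x)) \<and> (\<forall>x\<in>A. \<bar>f x\<bar> \<le> B) \<and>
     (\<forall>x. norm (gradient f x) \<le> B) \<and>
     (\<forall>x y. dist (gradient f x) (gradient f y) \<le> B * dist x y powr \<alpha>)"

lemma C1_holder_leD:
  assumes "C1_holder_le \<alpha> A B f"
  shows "f differentiable (at x)" "x \<in> A \<Longrightarrow> \<bar>f x\<bar> \<le> B" "norm (gradient f x) \<le> B"
    "dist (gradient f x) (gradient f y) \<le> B * dist x y powr \<alpha>" "0 \<le> B"
proof -
  show "norm (gradient f x) \<le> B" using assms by (auto simp: C1_holder_le_def)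
  then show "0 \<le> B" using norm_ge_zero order_trans by blast
qed (use assms in \<open>auto simp: C1_holder_le_def\<close>)

lemma C1_holder_le_mono:
  assumes "C1_holder_le \<alpha> A B f" "B \<le> B'"
  shows "C1_holder_le \<alpha> A B' f"
  unfolding C1_holder_le_def
  using assms C1_holder_leD[OF assms(1)] 
  by (meson mult_right_mono order_trans powr_ge_zero)

lemma C1_holder_le_diff:
  assumes f: "C1_holder_le \<alpha> A B f" and g: "C1_holder_le \<alpha> A B' g"
  shows "C1_holder_le \<alpha> A (B + B') (\<lambda>x. f x - g x)"
  unfolding C1_holder_le_def
proof (intro conjI allI ballI)
  note F = C1_holder_leD[OF f] and G = C1_holder_leD[OF g]
  have grad: "gradient (\<lambda>x. f x - g x) x = gradient f x - gradient g x" for x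
    by (intro gradient_diff F G)
  fix x y
  show "(\<lambda>x. f x - g x) differentiable (at x)"
    by (intro differentiable_diff F G)
  show "\<bar>f x - g x\<bar> \<le> B + B'" if "x \<in> A"
    using F(2)[OF that] G(2)[OF that] by linarith
  show "norm (gradient (\<lambda>x. f x - g x) x) \<le> B + B'"
    unfolding grad using norm_triangle_ineq4 F(3)[of x] G(3)[of x] by (meson add_mono order_trans)
  have "dist (gradient f x - gradient g x) (gradient f y - gradient g y)
      \<le> dist (gradient f x) (gradient f y) + dist (gradient g x) (gradient g y)"
    unfolding dist_norm by norm
  also have "\<dots> \<le> (B + B') * dist x y powr \<alpha>"
    using F(4)[of x y] G(4)[of x y] by (simp add: distrib_right)
  finally show "dist (gradient (\<lambda>x. f x - g x) x) (gradient (\<lambda>x. f x - g x) y)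
      \<le> (B + B') * dist x y powr \<alpha>" unfolding grad .
qed

lemma C1_holder_le_zero: "0 \<le> B \<Longrightarrow> C1_holder_le \<alpha> A B (\<lambda>x. 0)"
  by (simp add: C1_holder_le_def gradient_eqI[where g = 0])

lemma C1_holder_le_uminus: "C1_holder_le \<alpha> A B f \<Longrightarrow> C1_holder_le \<alpha> A B (\<lambda>x. - f x)"
  using C1_holder_le_diff[OF C1_holder_le_zero[of 0]] by fastforce

lemma C1_holder_le_add:
  assumes "C1_holder_le \<alpha> A B f" "C1_holder_le \<alpha> A B' g"
  shows "C1_holder_le \<alpha> A (B + B') (\<lambda>x. f x + g x)"
  using C1_holder_le_diff[OF assms(1) C1_holder_le_uminus[OF assms(2)]] by simp

section \<open>The heat kernel on space-time\<close>

lemma heat_kernel_nonneg: "0 \<le> heat_kernel r y"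
  by (simp add: heat_kernel_def)

lemma borel_measurable_heat_kernel [measurable (raw)]:
  fixes g :: "'c \<Rightarrow> 'a::euclidean_space"
  assumes [measurable]: "f \<in> borel_measurable M" "g \<in> borel_measurable M"
  shows "(\<lambda>p. heat_kernel (f p) (g p)) \<in> borel_measurable M"
  unfolding heat_kernel_def by measurable

lemma heat_kernel_eq_prod:
  assumes "0 < r"
  shows "heat_kernel r (y::'a::euclidean_space) = (\<Prod>i\<in>Basis. normal_density 0 (sqrt r) (y \<bullet> i))"
proof -
  have "(\<Prod>i\<in>(Basis::'a set). normal_density 0 (sqrt r) (y \<bullet> i))
      = (1 / sqrt (2 * pi * r)) ^ DIM('a) * exp (\<Sum>i\<in>Basis. - (y \<bullet> i)\<^sup>2 / (2 * r))"
    using assms by (simp add: normal_density_def prod.distrib exp_sum prod_dividef power_one_over)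
  also have "(\<Sum>i\<in>Basis. - (y \<bullet> i)\<^sup>2 / (2 * r)) = - (norm y)\<^sup>2 / (2 * r)"
    by (subst power2_norm_eq_inner, subst euclidean_inner)
      (simp add: power2_eq_square sum_divide_distrib sum_negf)
  also have "(1 / sqrt (2 * pi * r)) ^ DIM('a) = (2 * pi * r) powr (- real DIM('a) / 2)"
    using assms by (simp add: powr_half_sqrt[symmetric] powr_power powr_minus_divide power_one_over)
  finally show ?thesis by (simp add: heat_kernel_def)
qed

lemma nn_integral_heat_kernel:
  assumes "0 < r"
  shows "(\<integral>\<^sup>+y. heat_kernel r (y::'a::euclidean_space) \<partial>lborel) = 1"
proof -
  have 1: "(\<integral>\<^sup>+u. ennreal (normal_density 0 (sqrt r) u) \<partial>lborel) = 1"
    using assms by (subst nn_integral_eq_integral) auto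
  have "(\<integral>\<^sup>+y. heat_kernel r (y::'a) \<partial>lborel)
      = (\<integral>\<^sup>+y. (\<Prod>i\<in>Basis. ennreal (normal_density 0 (sqrt r) (y \<bullet> (i::'a)))) \<partial>lborel)"
    using assms by (simp add: heat_kernel_eq_prod prod_ennreal)
  also have "\<dots> = (\<Prod>i\<in>(Basis::'a set). \<integral>\<^sup>+u. ennreal (normal_density 0 (sqrt r) u) \<partial>lborel)"
    by (rule nn_integral_lborel_prod) auto
  also have "\<dots> = 1" by (simp add: 1)
  finally show ?thesis .
qed

text \<open>
  Half of the Gaussian decay absorbs the linear factor: with \<open>u = \<bar>y\<bar> / \<surd>r\<close> the claim is
  \<open>u exp (-u\<^sup>2/2) \<le> exp (-u\<^sup>2/4)\<close>, and \<open>u \<le> 1 + u\<^sup>2/4 \<le> exp (u\<^sup>2/4)\<close>.  The right-hand side is again a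
  heat kernel, so this bounds the first moment without computing it.
\<close>

lemma norm_mult_heat_kernel_le:
  fixes y :: "'a::euclidean_space"
  assumes "0 < r"
  shows "norm y * heat_kernel r y \<le> sqrt r * 2 powr (DIM('a) / 2) * heat_kernel (2 * r) y"
proof -
  define u where "u = norm y / sqrt r"
  have u: "norm y = sqrt r * u" using assms by (simp add: u_def)
  have "0 \<le> (1 - u / 2)\<^sup>2" by simp
  then have "u \<le> 1 + u\<^sup>2 / 4" by (simp add: power2_eq_square field_simps)
  also have "\<dots> \<le> exp (u\<^sup>2 / 4)" by simp
  finally have "u * exp (- u\<^sup>2 / 2) \<le> exp (u\<^sup>2 / 4) * exp (- u\<^sup>2 / 2)"
    by (rule mult_right_mono) simp
  also have "\<dots> = exp (- u\<^sup>2 / 4)" by (simp flip: exp_add)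
  finally have e: "u * exp (- u\<^sup>2 / 2) \<le> exp (- u\<^sup>2 / 4)" .
  have "norm y * heat_kernel r y
      = sqrt r * (2 * pi * r) powr (- real DIM('a) / 2) * (u * exp (- u\<^sup>2 / 2))"
    using assms by (simp add: heat_kernel_def u power_mult_distrib)
  also have "\<dots> \<le> sqrt r * (2 * pi * r) powr (- real DIM('a) / 2) * exp (- u\<^sup>2 / 4)"
    using assms by (intro mult_left_mono e) auto
  also have "(2 * pi * r) powr (- real DIM('a) / 2)
      = 2 powr (DIM('a) / 2) * (2 * pi * (2 * r)) powr (- real DIM('a) / 2)"
    using assms by (simp add: powr_mult powr_minus field_simps flip: powr_add)
  also have "sqrt r * (2 powr (DIM('a) / 2) * (2 * pi * (2 * r)) powr (- real DIM('a) / 2)) * exp (- u\<^sup>2 / 4)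
      = sqrt r * 2 powr (DIM('a) / 2) * heat_kernel (2 * r) y"
    using assms by (simp add: heat_kernel_def u power_mult_distrib)
  finally show ?thesis .
qed

text \<open>
  With time and space in one measure, the potential becomes a single integral, and one application
  of dominated convergence differentiates it.
\<close>

definition heat_measure :: "real \<Rightarrow> real \<Rightarrow> (real \<times> 'a::euclidean_space) measure" where
  "heat_measure a b = density (lborel \<Otimes>\<^sub>M lborel)
     (\<lambda>p. ennreal (indicator {a<..b} (fst p) * heat_kernel (fst p) (snd p)))"

lemma sets_heat_measure [measurable_cong]: "sets (heat_measure a b) = sets (borel \<Otimes>\<^sub>M borel)"
  unfolding heat_measure_def by (simp cong: sets_pair_measure_cong)

lemma space_heat_measure [simp]: "space (heat_measure a b) = UNIV"
  unfolding heat_measure_def by (simp add: space_pair_measure)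

lemma nn_integral_heat_measure:
  fixes f :: "real \<times> 'a::euclidean_space \<Rightarrow> ennreal"
  assumes [measurable]: "f \<in> borel_measurable (borel \<Otimes>\<^sub>M borel)"
  shows "(\<integral>\<^sup>+p. f p \<partial>heat_measure a b)
    = (\<integral>\<^sup>+r. indicator {a<..b} r * (\<integral>\<^sup>+y. heat_kernel r y * f (r, y) \<partial>lborel) \<partial>lborel)"
proof -
  have "(\<integral>\<^sup>+p. f p \<partial>heat_measure a b)
    = (\<integral>\<^sup>+p. ennreal (indicator {a<..b} (fst p) * heat_kernel (fst p) (snd p)) * f p
        \<partial>(lborel \<Otimes>\<^sub>M lborel))"
    unfolding heat_measure_def by (rule nn_integral_density) simp_all
  also have "\<dots> = (\<integral>\<^sup>+r. \<integral>\<^sup>+y. ennreal (indicator {a<..b} r * heat_kernel r y) * f (r, y)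
      \<partial>lborel \<partial>lborel)"
    by (subst lborel.nn_integral_fst[symmetric]) simp_all
  also have "\<dots> = (\<integral>\<^sup>+r. indicator {a<..b} r * (\<integral>\<^sup>+y. heat_kernel r y * f (r, y) \<partial>lborel) \<partial>lborel)"
    by (auto intro!: nn_integral_cong split: split_indicator)
  finally show ?thesis .
qed

lemma emeasure_heat_measure:
  assumes "0 \<le> a" "a \<le> b"
  shows "emeasure (heat_measure a b :: (real \<times> 'a::euclidean_space) measure) UNIV = b - a"
proof -
  have "emeasure (heat_measure a b :: (real \<times> 'a) measure) UNIV
      = (\<integral>\<^sup>+p. 1 \<partial>(heat_measure a b :: (real \<times> 'a) measure))"
    by simp
  also have "\<dots> = (\<integral>\<^sup>+r. indicator {a<..b} r \<partial>lborel)"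
    using assms by (subst nn_integral_heat_measure)
      (auto intro!: nn_integral_cong simp: nn_integral_heat_kernel split: split_indicator
        simp del: nn_integral_indicator)
  also have "\<dots> = b - a" using assms by simp
  finally show ?thesis .
qed

lemma finite_measure_heat_measure:
  assumes "0 \<le> a" "a \<le> b"
  shows "finite_measure (heat_measure a b :: (real \<times> 'a::euclidean_space) measure)"
  by (rule finite_measureI) (simp add: emeasure_heat_measure[OF assms])

lemma measure_heat_measure:
  assumes "0 \<le> a" "a \<le> b"
  shows "measure (heat_measure a b :: (real \<times> 'a::euclidean_space) measure) UNIV = b - a"
  using assms by (simp add: measure_def emeasure_heat_measure)

lemma heat_measure_first_moment:
  assumes "0 \<le> a" "a \<le> b" "b \<le> T"
  shows "integrable (heat_measure a b) (\<lambda>p. norm (snd p :: 'a::euclidean_space))"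
    and "(\<integral>p. norm (snd p :: 'a) \<partial>heat_measure a b) \<le> sqrt T * 2 powr (DIM('a) / 2) * (b - a)"
proof -
  define c where "c = sqrt T * 2 powr (DIM('a) / 2)"
  have T: "0 \<le> T" and c: "0 \<le> c" using assms by (auto simp: c_def)
  have inner: "(\<integral>\<^sup>+y. ennreal (heat_kernel r y) * ennreal (norm (y::'a)) \<partial>lborel) \<le> ennreal c"
    if "r \<in> {a<..b}" for r
  proof -
    have r: "0 < r" "r \<le> T" using that assms by auto
    have "(\<integral>\<^sup>+y. ennreal (heat_kernel r y) * ennreal (norm (y::'a)) \<partial>lborel)
        \<le> (\<integral>\<^sup>+y. ennreal c * ennreal (heat_kernel (2 * r) (y::'a)) \<partial>lborel)"
    proof (rule nn_integral_mono)
      fix y :: 'a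
      have "norm y * heat_kernel r y \<le> sqrt r * 2 powr (DIM('a) / 2) * heat_kernel (2 * r) y"
        by (rule norm_mult_heat_kernel_le) fact
      also have "\<dots> \<le> c * heat_kernel (2 * r) y"
        unfolding c_def using r by (intro mult_right_mono heat_kernel_nonneg) auto
      finally show "ennreal (heat_kernel r y) * ennreal (norm y)
          \<le> ennreal c * ennreal (heat_kernel (2 * r) y)"
        using c by (simp add: heat_kernel_nonneg mult.commute flip: ennreal_mult)
    qed
    also have "\<dots> = ennreal c"
      using r by (simp add: nn_integral_cmult nn_integral_heat_kernel)
    finally show ?thesis .
  qed
  have nn: "(\<integral>\<^sup>+p. ennreal (norm (snd p :: 'a)) \<partial>heat_measure a b) \<le> ennreal (c * (b - a))"
  proof -
    have "(\<integral>\<^sup>+p. ennreal (norm (snd p :: 'a)) \<partial>heat_measure a b)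
        \<le> (\<integral>\<^sup>+r. ennreal c * indicator {a<..b} r \<partial>lborel)"
      by (subst nn_integral_heat_measure)
        (auto intro!: nn_integral_mono inner split: split_indicator)
    also have "\<dots> = ennreal (c * (b - a))"
      using assms c by (simp add: nn_integral_cmult ennreal_mult)
    finally show ?thesis .
  qed
  show int: "integrable (heat_measure a b) (\<lambda>p. norm (snd p :: 'a))"
    by (rule integrableI_bounded) (use nn in \<open>auto simp: less_top[symmetric] top_unique\<close>)
  have "ennreal (\<integral>p. norm (snd p :: 'a) \<partial>heat_measure a b) \<le> ennreal (c * (b - a))"
    using nn by (subst nn_integral_eq_integral[symmetric]) (use int in auto)
  then show "(\<integral>p. norm (snd p :: 'a) \<partial>heat_measure a b) \<le> sqrt T * 2 powr (DIM('a) / 2) * (b - a)"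
    using assms c by (simp add: ennreal_le_iff c_def)
qed

section \<open>Averages against the heat kernel\<close>

definition heat_average ::
    "real \<Rightarrow> real \<Rightarrow> (real \<Rightarrow> 'a::euclidean_space \<Rightarrow> real) \<Rightarrow> 'a \<Rightarrow> real" where
  "heat_average a b g x = (\<integral>p. g (fst p) (x - snd p) \<partial>heat_measure a b)"

lemma heat_semigroup_eq_convolution:
  fixes f :: "'a::euclidean_space \<Rightarrow> real"
  assumes "0 < r" and [measurable]: "f \<in> borel_measurable borel"
  shows "heat_semigroup r f x = (\<integral>y. heat_kernel r y * f (x - y) \<partial>lborel)"
proof -
  have refl: "lborel = distr lborel borel (\<lambda>y. x - y)"
    using lborel_affine[of "-1" x] by (simp add: density_1)
  have "heat_semigroup r f x = (\<integral>y. heat_kernel r (x - y) * f y \<partial>lborel)"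
    using assms by (simp add: heat_semigroup_def)
  also have "\<dots> = (\<integral>y. heat_kernel r (x - y) * f y \<partial>distr lborel borel (\<lambda>y. x - y))"
    by (subst refl) simp
  also have "\<dots> = (\<integral>y. heat_kernel r y * f (x - y) \<partial>lborel)"
    by (subst integral_distr) simp_all
  finally show ?thesis .
qed

text \<open>
  The left endpoint is excluded because the kernel is no density at time \<open>0\<close>; for \<open>a \<ge> 0\<close> the
  convolution formula then applies at every time of the interval.
\<close>

lemma heat_average_eq_integral_heat_semigroup:
  fixes g :: "real \<Rightarrow> 'a::euclidean_space \<Rightarrow> real"
  assumes [measurable]: "(\<lambda>p. g (fst p) (snd p)) \<in> borel_measurable (borel \<Otimes>\<^sub>M borel)"
    and int: "integrable (heat_measure a b) (\<lambda>p. g (fst p) (x - snd p))"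
    and "0 \<le> a"
  shows "heat_average a b g x = (LINT r:{a<..b}|lborel. heat_semigroup r (g r) x)"
proof -
  have [measurable]: "(\<lambda>p. g (fst p) (x - snd p)) \<in> borel_measurable (borel \<Otimes>\<^sub>M borel)"
  proof -
    have "(\<lambda>p. (fst p, x - snd p)) \<in> (borel \<Otimes>\<^sub>M borel) \<rightarrow>\<^sub>M (borel \<Otimes>\<^sub>M (borel :: 'a measure))"
      by measurable
    from measurable_compose[OF this assms(1)] show ?thesis by simp
  qed
  have [measurable]: "g r \<in> borel_measurable borel" for r
    using measurable_compose[OF measurable_Pair1' assms(1), of r] by simp
  let ?w = "\<lambda>p. indicator {a<..b} (fst p) * heat_kernel (fst p) (snd p) :: real"
  have wint: "integrable (lborel \<Otimes>\<^sub>M lborel) (\<lambda>p. ?w p *\<^sub>R g (fst p) (x - snd p))"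
    using int unfolding heat_measure_def
    by (subst (asm) integrable_density) (auto simp: heat_kernel_nonneg)
  have "heat_average a b g x = (\<integral>p. ?w p *\<^sub>R g (fst p) (x - snd p) \<partial>(lborel \<Otimes>\<^sub>M lborel))"
    unfolding heat_average_def heat_measure_def
    by (subst integral_density) (auto simp: heat_kernel_nonneg)
  also have "\<dots> = (\<integral>r. \<integral>y. ?w (r, y) *\<^sub>R g r (x - y) \<partial>lborel \<partial>lborel)"
    using lborel_pair.integral_fst'[OF wint] by simp
  also have "\<dots> = (\<integral>r. indicator {a<..b} r *\<^sub>R heat_semigroup r (g r) x \<partial>lborel)"
    using \<open>0 \<le> a\<close> by (intro Bochner_Integration.integral_cong)
      (auto simp: heat_semigroup_eq_convolution split: split_indicator)
  finally show ?thesis by (simp add: set_lebesgue_integral_def)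
qed

lemma borel_measurable_shift:
  fixes F :: "real \<Rightarrow> 'a::euclidean_space \<Rightarrow> 'b::{second_countable_topology,real_normed_vector}"
  assumes "continuous_on UNIV (\<lambda>p. F (fst p) (snd p))"
  shows "(\<lambda>p. F (fst p) (x - snd p)) \<in> borel_measurable (heat_measure a b)"
proof -
  have "continuous_on UNIV (\<lambda>p. F (fst p) (x - snd p))"
    by (rule continuous_on_compose2[OF assms, of UNIV "\<lambda>p. (fst p, x - snd p)", simplified])
      (intro continuous_intros)
  then show ?thesis
    unfolding measurable_cong_sets[OF sets_heat_measure refl] borel_prod
    by (rule borel_measurable_continuous_onI)
qed

text \<open>
  The gradient bounds lose only the mass \<open>b - a\<close>.  The values on \<open>A\<close> are estimated through the mean
  value theorem and cost the first moment of the kernel, which is the second summand of the constant.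
  That \<open>A\<close> has a point at which all \<open>g r\<close> are bounded by the same \<open>B\<close> is what makes the
  integrand integrable.
\<close>

lemma
  fixes g :: "real \<Rightarrow> 'a::euclidean_space \<Rightarrow> real"
  assumes ab: "0 \<le> a" "a \<le> b" "b \<le> T" and A: "A \<noteq> {}"
    and cont: "continuous_on UNIV (\<lambda>p. g (fst p) (snd p))"
      "continuous_on UNIV (\<lambda>p. gradient (g (fst p)) (snd p))"
    and B: "\<And>r. C1_holder_le \<alpha> A B (g r)"
  shows integrable_heat_average: "integrable (heat_measure a b) (\<lambda>p. g (fst p) (x - snd p))"
    and C1_holder_le_heat_average:
      "C1_holder_le \<alpha> A ((1 + sqrt T * 2 powr (DIM('a) / 2)) * (b - a) * B) (heat_average a b g)"
proof -
  let ?M = "heat_measure a b :: (real \<times> 'a) measure"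
  define \<kappa> where "\<kappa> = sqrt T * 2 powr (DIM('a) / 2)"
  define f where "f p x = g (fst p) (x - snd p)" for p x
  define G where "G p x = gradient (g (fst p)) (x - snd p)" for p x
  interpret finite_measure ?M by (rule finite_measure_heat_measure[OF ab(1,2)])
  note moment = heat_measure_first_moment[OF ab, where 'a = 'a]
  note BD = C1_holder_leD[OF B]
  have B0: "0 \<le> B" by (rule BD(5))
  have \<kappa>0: "0 \<le> \<kappa>" using ab by (simp add: \<kappa>_def)
  have int_bound: "norm (\<integral>p. F p \<partial>?M) \<le> K * (b - a)"
    if "integrable ?M F" "\<And>p. norm (F p) \<le> K" for F :: "_ \<Rightarrow> 'a" and K
  proof -
    have "norm (\<integral>p. F p \<partial>?M) \<le> (\<integral>p. K \<partial>?M)"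
      by (rule Bochner_Integration.integral_norm_bound_integral) (use that in auto)
    then show ?thesis by (simp add: measure_heat_measure[OF ab(1,2)] mult.commute)
  qed
  have meas_f: "(\<lambda>p. f p x) \<in> borel_measurable ?M" for x
    unfolding f_def by (rule borel_measurable_shift[OF cont(1)])
  have meas_G: "(\<lambda>p. G p x) \<in> borel_measurable ?M" for x
    unfolding G_def by (rule borel_measurable_shift[OF cont(2)])
  have lip: "\<bar>f p x\<bar> \<le> \<bar>g (fst p) z\<bar> + B * norm (x - z) + B * norm (snd p)" for p x z
  proof -
    have "\<bar>g (fst p) (x - snd p) - g (fst p) z\<bar> \<le> B * norm (x - snd p - z)"
      by (rule dist_le_of_gradient_le) (rule BD)+
    also have "\<dots> \<le> B * (norm (x - z) + norm (snd p))"
      by (intro mult_left_mono B0) norm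
    finally show ?thesis by (simp add: f_def distrib_left)
  qed
  have int_f: "integrable ?M (\<lambda>p. f p x)" for x
  proof -
    obtain z where z: "z \<in> A" using A by auto
    show ?thesis
    proof (rule Bochner_Integration.integrable_bound[OF _ meas_f])
      show "integrable ?M (\<lambda>p. B + B * norm (x - z) + B * norm (snd p))"
        using moment(1) by auto
      show "AE p in ?M. norm (f p x) \<le> norm (B + B * norm (x - z) + B * norm (snd p))"
      proof (rule AE_I2)
        fix p
        show "norm (f p x) \<le> norm (B + B * norm (x - z) + B * norm (snd p))"
          using lip[of p x z] BD(2)[OF z, of "fst p"] by simp
      qed
    qed
  qed
  then show "integrable ?M (\<lambda>p. g (fst p) (x - snd p))" by (simp add: f_def)
  have int_G: "integrable ?M (\<lambda>p. G p x)" for x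
    by (rule integrable_const_bound[OF _ meas_G, of _ B]) (simp add: G_def BD)
  have "(f p has_derivative (\<lambda>v. G p x \<bullet> v)) (at x)" for p x
    unfolding f_def G_def
    by (rule has_derivative_compose[OF _ has_derivative_gradient[OF BD(1)], of "\<lambda>x. x - snd p" "\<lambda>v. v"])
      (auto intro!: derivative_eq_intros)
  then have deriv: "(heat_average a b g has_derivative (\<lambda>v. (\<integral>p. G p x \<partial>?M) \<bullet> v)) (at x)" for x
    using has_derivative_integral_gradient[of ?M f G x "\<lambda>p. B"] int_f meas_G
    by (simp add: heat_average_def[abs_def] f_def[symmetric]) (simp add: G_def BD)
  have grad: "gradient (heat_average a b g) x = (\<integral>p. G p x \<partial>?M)" for x
    by (rule gradient_eqI[OF deriv])
  have weaken: "B * (b - a) * u \<le> (1 + \<kappa>) * (b - a) * B * u" if "0 \<le> u" for u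
    using \<kappa>0 ab B0 that by (intro mult_right_mono) (auto simp: distrib_right)
  show "C1_holder_le \<alpha> A ((1 + sqrt T * 2 powr (DIM('a) / 2)) * (b - a) * B) (heat_average a b g)"
    unfolding C1_holder_le_def \<kappa>_def[symmetric]
  proof (intro conjI allI ballI)
    fix x y
    show "heat_average a b g differentiable (at x)" using deriv by (rule differentiableI)
    show "\<bar>heat_average a b g x\<bar> \<le> (1 + \<kappa>) * (b - a) * B" if x: "x \<in> A"
    proof -
      have "norm (\<integral>p. f p x \<partial>?M) \<le> (\<integral>p. B + B * norm (snd p) \<partial>?M)"
      proof (rule Bochner_Integration.integral_norm_bound_integral)
        show "norm (f p x) \<le> B + B * norm (snd p)" for p
          using lip[of p x x] BD(2)[OF x, of "fst p"] by simp
      qed (use int_f moment(1) in auto)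
      also have "\<dots> = B * (b - a) + B * (\<integral>p. norm (snd p) \<partial>?M)"
        using moment(1) by (simp add: measure_heat_measure[OF ab(1,2)])
      also have "\<dots> \<le> B * (b - a) + B * (\<kappa> * (b - a))"
        unfolding \<kappa>_def by (intro add_left_mono mult_left_mono moment(2) B0)
      finally show ?thesis by (simp add: heat_average_def f_def algebra_simps)
    qed
    have "norm (\<integral>p. G p x \<partial>?M) \<le> B * (b - a)"
      by (rule int_bound[OF int_G]) (simp add: G_def BD)
    then show "norm (gradient (heat_average a b g) x) \<le> (1 + \<kappa>) * (b - a) * B"
      using weaken[of 1] by (simp add: grad)
    have "norm (\<integral>p. G p x - G p y \<partial>?M) \<le> B * dist x y powr \<alpha> * (b - a)"
    proof (rule int_bound)
      show "norm (G p x - G p y) \<le> B * dist x y powr \<alpha>" for p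
        using BD(4)[of "fst p" "x - snd p" "y - snd p"] by (simp add: G_def dist_norm)
    qed (intro Bochner_Integration.integrable_diff int_G)
    then have "dist (gradient (heat_average a b g) x) (gradient (heat_average a b g) y)
        \<le> B * (b - a) * dist x y powr \<alpha>"
      unfolding grad dist_norm using int_G by (simp add: mult.commute mult.left_commute)
    also have "\<dots> \<le> (1 + \<kappa>) * (b - a) * B * dist x y powr \<alpha>" by (rule weaken) simp
    finally show "dist (gradient (heat_average a b g) x) (gradient (heat_average a b g) y)
        \<le> (1 + \<kappa>) * (b - a) * B * dist x y powr \<alpha>" .
  qed
qed

section \<open>The two norms are equivalent to the gauge\<close>

lemma norm_le_sup_norm:
  assumes "bounded (range f)"
  shows "norm (f x) \<le> sup_norm f"
proof -
  obtain b where "\<And>x. norm (f x) \<le> b" using assms unfolding bounded_iff by blast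
  then have "bdd_above (range (\<lambda>x. norm (f x)))" by (intro bdd_aboveI[of _ b]) blast
  then show ?thesis unfolding sup_norm_def by (rule cSUP_upper[OF UNIV_I])
qed

lemma sup_norm_le: "(\<And>x. norm (f x) \<le> B) \<Longrightarrow> sup_norm f \<le> B"
  unfolding sup_norm_def by (rule cSUP_least) simp_all

lemma sup_norm_nonneg: "bounded (range f) \<Longrightarrow> 0 \<le> sup_norm f"
  by (rule order_trans[OF norm_ge_zero norm_le_sup_norm])

text \<open>
  The supremum that defines the Hoelder seminorm is over a nonempty set.
\<close>

lemma offdiagonal_nonempty: "{(x, y). x \<noteq> (y::'a::euclidean_space)} \<noteq> {}"
proof -
  obtain i :: 'a where "i \<in> Basis" using nonempty_Basis by blast
  then have "(i, 0) \<in> {(x, y). x \<noteq> (y::'a)}" using nonzero_Basis by auto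
  then show ?thesis by blast
qed

lemma dist_le_holder_seminorm:
  assumes "is_holder 0 \<theta> f"
  shows "dist (f x) (f y) \<le> holder_seminorm \<theta> f * dist x y powr \<theta>"
proof (cases "x = y")
  case False
  from assms obtain C where C: "\<And>x y. dist (f x) (f y) \<le> C * dist x y powr \<theta>"
    unfolding is_holder.simps by blast
  have "dist (f x) (f y) / dist x y powr \<theta> \<le> holder_seminorm \<theta> f"
    unfolding holder_seminorm_def
  proof (rule cSUP_upper2[of _ _ "(x, y)"])
    show "bdd_above ((\<lambda>(x, y). dist (f x) (f y) / dist x y powr \<theta>) ` {(x, y). x \<noteq> y})"
      using C by (intro bdd_aboveI[of _ C]) (auto simp: divide_le_eq)
  qed (use False in auto)
  then show ?thesis using False by (simp add: divide_le_eq)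
qed simp

lemma holder_seminorm_le:
  fixes f :: "'a::euclidean_space \<Rightarrow> 'b::real_normed_vector"
  assumes "\<And>x y. dist (f x) (f y) \<le> B * dist x y powr \<theta>"
  shows "holder_seminorm \<theta> f \<le> B"
  unfolding holder_seminorm_def
  by (rule cSUP_least[OF offdiagonal_nonempty]) (use assms in \<open>auto simp: divide_le_eq\<close>)

lemma holder_seminorm_nonneg:
  fixes f :: "'a::euclidean_space \<Rightarrow> 'b::real_normed_vector"
  assumes "is_holder 0 \<theta> f"
  shows "0 \<le> holder_seminorm \<theta> f"
proof -
  obtain x y :: 'a where "x \<noteq> y" using offdiagonal_nonempty by blast
  have "0 \<le> holder_seminorm \<theta> f * dist x y powr \<theta>"
    by (rule order_trans[OF zero_le_dist dist_le_holder_seminorm[OF assms]])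
  then show ?thesis using \<open>x \<noteq> y\<close> by (simp add: zero_le_mult_iff)
qed

text \<open>
  A space \<open>X\<close> normed by \<open>N\<close>, up to the constant \<open>C\<close> the same as the gauge
  \<open>C1_holder_le\<close>, from which \<open>X\<close> inherits its linear structure and \<open>N\<close> a triangle inequality.
\<close>

locale C1_holder_norm =
  fixes \<alpha> :: real and A :: "'a::euclidean_space set" and X :: "('a \<Rightarrow> real) set"
    and N :: "('a \<Rightarrow> real) \<Rightarrow> real" and C :: real
  assumes \<alpha>_pos: "0 < \<alpha>" and nonempty: "A \<noteq> {}" and C_nonneg: "0 \<le> C"
    and C1_holder_le_norm: "f \<in> X \<Longrightarrow> C1_holder_le \<alpha> A (N f) f"
    and norm_le: "C1_holder_le \<alpha> A B f \<Longrightarrow> f \<in> X \<and> N f \<le> C * B"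

text \<open>
  The constant counts the summands of the norm: one for the function and two for each of the
  partial derivatives.
\<close>

lemma C1_holder_norm_holder_space:
  assumes "0 < \<alpha>" "\<alpha> < 1"
  shows "C1_holder_norm \<alpha> (UNIV :: 'a::euclidean_space set)
    (holder_space (\<alpha> + 1)) (holder_norm (\<alpha> + 1)) (1 + 2 * DIM('a))"
    (is "C1_holder_norm _ _ ?X ?N ?C")
proof
  have "\<lfloor>\<alpha>\<rfloor> = 0" using assms by (simp add: floor_eq_iff)
  then have fl: "?X = {f. is_holder (Suc 0) \<alpha> f}" "?N = holder_norm_aux (Suc 0) \<alpha>"
    by (auto simp: holder_space_def holder_norm_def frac_def)
  let ?D = "\<lambda>f i x. frechet_derivative f (at x) i :: real"
  fix f :: "'a \<Rightarrow> real" and B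
  show "C1_holder_le \<alpha> UNIV (?N f) f" if "f \<in> ?X"
  proof -
    have bdd: "bounded (range f)" and diff: "\<And>x. f differentiable (at x)"
      and D: "\<And>i. i \<in> Basis \<Longrightarrow> is_holder 0 \<alpha> (?D f i)"
      using that by (auto simp: fl)
    have N: "?N f = sup_norm f + (\<Sum>i\<in>Basis. sup_norm (?D f i) + holder_seminorm \<alpha> (?D f i))"
      by (simp add: fl)
    have D0: "0 \<le> sup_norm (?D f i)" "0 \<le> holder_seminorm \<alpha> (?D f i)" if "i \<in> Basis" for i
      using D[OF that] by (intro sup_norm_nonneg holder_seminorm_nonneg; simp)+
    have N1: "(\<Sum>i\<in>Basis. sup_norm (?D f i)) \<le> ?N f" "(\<Sum>i\<in>Basis. holder_seminorm \<alpha> (?D f i)) \<le> ?N f"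
      and N0: "sup_norm f \<le> ?N f"
      using sup_norm_nonneg[OF bdd] D0 unfolding N sum.distrib
      by (simp_all add: add_nonneg_nonneg sum_nonneg)
    show ?thesis
      unfolding C1_holder_le_def
    proof (intro conjI allI ballI)
      fix x y
      show "f differentiable (at x)" by (rule diff)
      show "\<bar>f x\<bar> \<le> ?N f" using norm_le_sup_norm[OF bdd, of x] N0 by simp
      have "norm (gradient f x) \<le> (\<Sum>i\<in>Basis. \<bar>?D f i x\<bar>)"
        unfolding gradient_def by (rule sum_norm_le) simp
      also have "\<dots> \<le> (\<Sum>i\<in>Basis. sup_norm (?D f i))"
      proof (rule sum_mono)
        fix i :: 'a assume "i \<in> Basis"
        then show "\<bar>?D f i x\<bar> \<le> sup_norm (?D f i)"
          using norm_le_sup_norm[of "?D f i" x] D by simp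
      qed
      finally show "norm (gradient f x) \<le> ?N f" using N1 by simp
      have "dist (gradient f x) (gradient f y) = norm (\<Sum>i\<in>Basis. (?D f i x - ?D f i y) *\<^sub>R i)"
        by (simp add: gradient_def dist_norm sum_subtractf scaleR_diff_left)
      also have "\<dots> \<le> (\<Sum>i\<in>Basis. dist (?D f i x) (?D f i y))"
        by (rule sum_norm_le) (simp add: dist_real_def)
      also have "\<dots> \<le> (\<Sum>i\<in>Basis. holder_seminorm \<alpha> (?D f i) * dist x y powr \<alpha>)"
        by (intro sum_mono dist_le_holder_seminorm D)
      also have "\<dots> \<le> ?N f * dist x y powr \<alpha>"
        using N1 by (simp add: sum_distrib_right[symmetric] mult_right_mono)
      finally show "dist (gradient f x) (gradient f y) \<le> ?N f * dist x y powr \<alpha>" .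
    qed
  qed
  show "f \<in> ?X \<and> ?N f \<le> ?C * B" if le: "C1_holder_le \<alpha> UNIV B f"
  proof -
    note L = C1_holder_leD[OF le]
    have f: "norm (f x) \<le> B" for x using L(2) by simp
    have D: "?D f i x = gradient f x \<bullet> i" for i x
      by (rule frechet_derivative_eq_gradient[OF L(1)])
    have Db: "norm (?D f i x) \<le> B" and Dh: "dist (?D f i x) (?D f i y) \<le> B * dist x y powr \<alpha>"
      if "i \<in> Basis" for i x y
    proof -
      show "norm (?D f i x) \<le> B"
        unfolding D using Basis_le_norm[OF that, of "gradient f x"] L(3)[of x] by simp
      have "dist (?D f i x) (?D f i y) = \<bar>(gradient f x - gradient f y) \<bullet> i\<bar>"
        by (simp add: D dist_real_def inner_diff_left)
      also have "\<dots> \<le> dist (gradient f x) (gradient f y)"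
        unfolding dist_norm by (rule Basis_le_norm[OF that])
      finally show "dist (?D f i x) (?D f i y) \<le> B * dist x y powr \<alpha>" using L(4)[of x y] by linarith
    qed
    have "is_holder 0 \<alpha> (?D f i)" if "i \<in> Basis" for i
      using Db[OF that] Dh[OF that] by (auto simp: bounded_iff)
    then have "f \<in> ?X"
      using f L(1) by (auto simp: fl bounded_iff simp del: real_norm_def)
    moreover have "?N f \<le> B + (\<Sum>i\<in>(Basis::'a set). B + B)"
      unfolding fl holder_norm_aux.simps
      by (intro add_mono sum_mono sup_norm_le holder_seminorm_le f Db Dh)
    ultimately show ?thesis by (simp add: algebra_simps)
  qed
qed (use assms in auto)

text \<open>
  Here the norm has three summands.  A larger \<open>C\<close> is admitted so that both spaces can share one
  constant.
\<close>

lemma C1_holder_norm_D_holder_space: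
  assumes "0 < \<alpha>" "\<alpha> < 1" "3 \<le> C"
  shows "C1_holder_norm \<alpha> {0 :: 'a::euclidean_space} (D_holder_space \<alpha>) (D_holder_norm \<alpha>) C"
proof
  have fl: "\<lfloor>\<alpha>\<rfloor> = 0" "frac \<alpha> = \<alpha>"
    using assms by (simp_all add: floor_eq_iff frac_eq)
  fix f :: "'a \<Rightarrow> real" and B
  show "C1_holder_le \<alpha> {0} (D_holder_norm \<alpha> f) f" if "f \<in> D_holder_space \<alpha>"
  proof -
    have diff: "\<And>x. f differentiable (at x)" and D: "is_holder 0 \<alpha> (gradient f)"
      using that by (auto simp: D_holder_space_def holder_space_def fl)
    have N: "D_holder_norm \<alpha> f = \<bar>f 0\<bar> + (sup_norm (gradient f) + holder_seminorm \<alpha> (gradient f))"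
      by (simp add: D_holder_norm_def holder_norm_def fl)
    have bdd: "bounded (range (gradient f))" using D by simp
    note pos = sup_norm_nonneg[OF bdd] holder_seminorm_nonneg[OF D]
    show ?thesis
      unfolding C1_holder_le_def
    proof (intro conjI allI ballI)
      fix x y
      show "f differentiable (at x)" by (rule diff)
      show "\<bar>f x\<bar> \<le> D_holder_norm \<alpha> f" if "x \<in> {0}" using that pos by (simp add: N)
      show "norm (gradient f x) \<le> D_holder_norm \<alpha> f"
        using norm_le_sup_norm[OF bdd, of x] pos by (simp add: N)
      have "dist (gradient f x) (gradient f y) \<le> holder_seminorm \<alpha> (gradient f) * dist x y powr \<alpha>"
        by (rule dist_le_holder_seminorm[OF D])
      also have "\<dots> \<le> D_holder_norm \<alpha> f * dist x y powr \<alpha>"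
        using pos by (intro mult_right_mono) (auto simp: N)
      finally show "dist (gradient f x) (gradient f y) \<le> D_holder_norm \<alpha> f * dist x y powr \<alpha>" .
    qed
  qed
  show "f \<in> D_holder_space \<alpha> \<and> D_holder_norm \<alpha> f \<le> C * B" if le: "C1_holder_le \<alpha> {0} B f"
  proof -
    note L = C1_holder_leD[OF le]
    have "is_holder 0 \<alpha> (gradient f)" using L(3,4) by (auto simp: bounded_iff)
    then have "f \<in> D_holder_space \<alpha>"
      using L(1) by (auto simp: D_holder_space_def holder_space_def fl)
    moreover have "D_holder_norm \<alpha> f \<le> B + (B + B)"
      using L(2)[of 0] unfolding D_holder_norm_def holder_norm_def fl nat_zero_as_int[symmetric]
        holder_norm_aux.simps
      by (intro add_mono sup_norm_le holder_seminorm_le L(3,4)) auto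
    moreover have "3 * B \<le> C * B" using assms(3) L(5) by (rule mult_right_mono)
    ultimately show ?thesis by simp
  qed
qed (use assms in auto)

section \<open>Continuity in time\<close>

context C1_holder_norm
begin

lemma norm_nonneg: "f \<in> X \<Longrightarrow> 0 \<le> N f"
  by (rule C1_holder_leD(5)[OF C1_holder_le_norm])

text \<open>
  Since the gauge and \<open>N\<close> dominate each other, they define the same continuous curves; the gauge is
  the side on which sums and differences can be estimated.
\<close>

lemma CT_iff:
  "h \<in> CT T X N \<longleftrightarrow>
    (\<forall>t\<in>{0..T}. \<exists>B. C1_holder_le \<alpha> A B (h t)) \<and>
    (\<forall>t\<in>{0..T}. \<forall>\<epsilon>>0. \<forall>\<^sub>F s in at t within {0..T}. C1_holder_le \<alpha> A \<epsilon> (\<lambda>x. h s x - h t x))"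
    (is "_ \<longleftrightarrow> ?P \<and> ?Q")
proof -
  have memb: "(\<forall>t\<in>{0..T}. h t \<in> X) \<longleftrightarrow> ?P"
    using C1_holder_le_norm norm_le by blast
  have "(\<forall>t\<in>{0..T}. ((\<lambda>s. N (\<lambda>x. h s x - h t x)) \<longlongrightarrow> 0) (at t within {0..T})) \<longleftrightarrow> ?Q"
    if P: ?P
  proof (intro ball_cong refl)
    fix t assume t: "t \<in> {0..T}"
    have ev: "\<forall>\<^sub>F s in at t within {0..T}. s \<in> {0..T}"
      by (simp add: eventually_at_filter)
    have X: "(\<lambda>x. h s x - h t x) \<in> X" if "s \<in> {0..T}" for s
      using C1_holder_le_diff P t that norm_le by metis
    show "((\<lambda>s. N (\<lambda>x. h s x - h t x)) \<longlongrightarrow> 0) (at t within {0..T}) \<longleftrightarrow>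
      (\<forall>\<epsilon>>0. \<forall>\<^sub>F s in at t within {0..T}. C1_holder_le \<alpha> A \<epsilon> (\<lambda>x. h s x - h t x))"
    proof (intro iffI allI impI)
      fix \<epsilon> :: real
      assume "((\<lambda>s. N (\<lambda>x. h s x - h t x)) \<longlongrightarrow> 0) (at t within {0..T})" "0 < \<epsilon>"
      then have "\<forall>\<^sub>F s in at t within {0..T}. N (\<lambda>x. h s x - h t x) < \<epsilon>"
        by (rule order_tendstoD(2))
      with ev show "\<forall>\<^sub>F s in at t within {0..T}. C1_holder_le \<alpha> A \<epsilon> (\<lambda>x. h s x - h t x)"
        by eventually_elim (use X in \<open>auto intro: C1_holder_le_mono[OF C1_holder_le_norm]\<close>)
    next
      assume Q: "\<forall>\<epsilon>>0. \<forall>\<^sub>F s in at t within {0..T}. C1_holder_le \<alpha> A \<epsilon> (\<lambda>x. h s x - h t x)"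
      show "((\<lambda>s. N (\<lambda>x. h s x - h t x)) \<longlongrightarrow> 0) (at t within {0..T})"
      proof (rule tendstoI)
        fix e :: real assume e: "0 < e"
        define \<epsilon> where "\<epsilon> = e / (C + 1)"
        have \<epsilon>: "0 < \<epsilon>" "C * \<epsilon> < e" using e C_nonneg by (auto simp: \<epsilon>_def divide_simps)
        then have "\<forall>\<^sub>F s in at t within {0..T}. C1_holder_le \<alpha> A \<epsilon> (\<lambda>x. h s x - h t x)"
          using Q by blast
        with ev show "\<forall>\<^sub>F s in at t within {0..T}. dist (N (\<lambda>x. h s x - h t x)) 0 < e"
        proof eventually_elim
          case (elim s)
          have "N (\<lambda>x. h s x - h t x) < e" using norm_le[OF elim(2)] \<epsilon> by linarith
          then show ?case using norm_nonneg[OF X[OF elim(1)]] by simp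
        qed
      qed
    qed
  qed
  then show ?thesis unfolding CT_def mem_Collect_eq memb by blast
qed

end

text \<open>
  The Heine-Cantor argument, which needs only the triangle inequality of the gauge: two times closer
  than a Lebesgue number of the cover by neighbourhoods of continuity lie in one such neighbourhood.
\<close>

lemma C1_holder_uniformly_continuous:
  fixes h :: "'t::heine_borel \<Rightarrow> 'a::euclidean_space \<Rightarrow> real"
  assumes K: "compact K" and "0 < \<epsilon>"
    and cont: "\<And>t \<epsilon>. t \<in> K \<Longrightarrow> 0 < \<epsilon> \<Longrightarrow>
      \<forall>\<^sub>F s in at t within K. C1_holder_le \<alpha> A \<epsilon> (\<lambda>x. h s x - h t x)"
  shows "\<exists>\<delta>>0. \<forall>s\<in>K. \<forall>t\<in>K. dist s t < \<delta> \<longrightarrow> C1_holder_le \<alpha> A \<epsilon> (\<lambda>x. h s x - h t x)"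
proof -
  have "\<exists>\<delta>>0. \<forall>s\<in>K. dist s t < \<delta> \<longrightarrow> C1_holder_le \<alpha> A (\<epsilon> / 2) (\<lambda>x. h s x - h t x)"
    if t: "t \<in> K" for t
  proof -
    obtain \<delta> where "0 < \<delta>"
      "\<And>s. s \<in> K \<Longrightarrow> s \<noteq> t \<Longrightarrow> dist s t < \<delta> \<Longrightarrow> C1_holder_le \<alpha> A (\<epsilon> / 2) (\<lambda>x. h s x - h t x)"
      using cont[OF t, of "\<epsilon> / 2"] \<open>0 < \<epsilon>\<close> by (auto simp: eventually_at)
    moreover have "C1_holder_le \<alpha> A (\<epsilon> / 2) (\<lambda>x. h t x - h t x)"
      using C1_holder_le_zero[of "\<epsilon> / 2"] \<open>0 < \<epsilon>\<close> by simp
    ultimately show ?thesis by metis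
  qed
  then obtain d where d: "\<And>t. t \<in> K \<Longrightarrow> 0 < d t"
    "\<And>s t. t \<in> K \<Longrightarrow> s \<in> K \<Longrightarrow> dist s t < d t \<Longrightarrow> C1_holder_le \<alpha> A (\<epsilon> / 2) (\<lambda>x. h s x - h t x)"
    by metis
  have "K \<subseteq> \<Union>((\<lambda>t. ball t (d t)) ` K)" using d(1) by auto
  from Heine_Borel_lemma[OF K this] obtain \<delta> where \<delta>: "0 < \<delta>"
    "\<And>x. x \<in> K \<Longrightarrow> \<exists>G\<in>(\<lambda>t. ball t (d t)) ` K. ball x \<delta> \<subseteq> G"
    by auto
  have "C1_holder_le \<alpha> A \<epsilon> (\<lambda>x. h s x - h t x)" if st: "s \<in> K" "t \<in> K" "dist s t < \<delta>" for s t
  proof -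
    obtain u where u: "u \<in> K" "ball s \<delta> \<subseteq> ball u (d u)" using \<delta>(2)[OF st(1)] by auto
    have "s \<in> ball s \<delta>" "t \<in> ball s \<delta>" using \<delta>(1) st by auto
    then have "s \<in> ball u (d u)" "t \<in> ball u (d u)" using u(2) by blast+
    then have "dist s u < d u" "dist t u < d u" by (simp_all add: dist_commute)
    with u st have "C1_holder_le \<alpha> A (\<epsilon> / 2) (\<lambda>x. h s x - h u x)"
      "C1_holder_le \<alpha> A (\<epsilon> / 2) (\<lambda>x. h t x - h u x)" using d(2) by auto
    from C1_holder_le_diff[OF this] show ?thesis by simp
  qed
  with \<delta>(1) show ?thesis by blast
qed

lemma C1_holder_bounded:
  fixes h :: "'t::heine_borel \<Rightarrow> 'a::euclidean_space \<Rightarrow> real"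
  assumes K: "compact K" and memb: "\<And>t. t \<in> K \<Longrightarrow> \<exists>B. C1_holder_le \<alpha> A B (h t)"
    and cont: "\<And>t \<epsilon>. t \<in> K \<Longrightarrow> 0 < \<epsilon> \<Longrightarrow>
      \<forall>\<^sub>F s in at t within K. C1_holder_le \<alpha> A \<epsilon> (\<lambda>x. h s x - h t x)"
  shows "\<exists>B. \<forall>t\<in>K. C1_holder_le \<alpha> A B (h t)"
proof -
  obtain \<delta> where \<delta>: "0 < \<delta>"
    "\<And>s t. s \<in> K \<Longrightarrow> t \<in> K \<Longrightarrow> dist s t < \<delta> \<Longrightarrow> C1_holder_le \<alpha> A 1 (\<lambda>x. h s x - h t x)"
    using C1_holder_uniformly_continuous[OF K zero_less_one cont] by metis
  obtain D where D: "finite D" "D \<subseteq> K" "K \<subseteq> (\<Union>t\<in>D. ball t \<delta>)"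
  proof (rule compactE_image[OF K, of K "\<lambda>t. ball t \<delta>"])
    show "K \<subseteq> (\<Union>t\<in>K. ball t \<delta>)" using \<delta>(1) by auto
  qed auto
  obtain b where b: "\<And>t. t \<in> K \<Longrightarrow> C1_holder_le \<alpha> A (b t) (h t)" using memb by metis
  have "C1_holder_le \<alpha> A (1 + (\<Sum>u\<in>D. b u)) (h t)" if t: "t \<in> K" for t
  proof -
    obtain u where u: "u \<in> D" "dist t u < \<delta>" using D(3) t by (auto simp: dist_commute)
    then have "u \<in> K" using D(2) by auto
    from C1_holder_le_add[OF \<delta>(2)[OF t this u(2)] b[OF this]]
    have "C1_holder_le \<alpha> A (1 + b u) (h t)" by simp
    moreover have "b u \<le> (\<Sum>u\<in>D. b u)"
      using D u b by (intro member_le_sum) (auto intro: C1_holder_leD(5))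
    ultimately show ?thesis using C1_holder_le_mono by fastforce
  qed
  then show ?thesis by blast
qed

text \<open>
  Joint continuity, which provides the measurability on space-time.  The weight \<open>w\<close> is there
  because when \<open>A\<close> is a single point, a small gauge controls a function only up to linear growth.
\<close>

lemma continuous_on_pair_of_locally_uniform:
  fixes F :: "real \<Rightarrow> 'a::metric_space \<Rightarrow> 'b::metric_space" and w :: "'a \<Rightarrow> real"
  assumes slice: "\<And>r x. isCont (F r) x" and w: "\<And>x. isCont w x" 
    and unif: "\<And>r \<epsilon>. 0 < \<epsilon> \<Longrightarrow> \<exists>\<delta>>0. \<forall>s. dist s r < \<delta> \<longrightarrow> (\<forall>y. dist (F s y) (F r y) \<le> \<epsilon> * w y)"
  shows "continuous_on UNIV (\<lambda>p. F (fst p) (snd p))"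
  unfolding continuous_on_def
proof (intro ballI tendstoI)
  fix p :: "real \<times> 'a" and e :: real assume e: "0 < e"
  obtain r x where p: "p = (r, x)" by (cases p)
  define \<epsilon> where "\<epsilon> = e / (2 * (\<bar>w x\<bar> + 1))"
  have \<epsilon>: "0 < \<epsilon>" "\<epsilon> * (\<bar>w x\<bar> + 1) = e / 2" using e by (auto simp: \<epsilon>_def field_simps)
  obtain \<delta> where \<delta>: "0 < \<delta>" "\<And>s y. dist s r < \<delta> \<Longrightarrow> dist (F s y) (F r y) \<le> \<epsilon> * w y"
    using unif[OF \<epsilon>(1)] by metis
  have lim: "(fst \<longlongrightarrow> r) (at p)" "(snd \<longlongrightarrow> x) (at p)"
    using tendsto_fst[of "\<lambda>q. q" p "at p"] tendsto_snd[of "\<lambda>q. q" p "at p"] by (simp_all add: p)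
  have "\<forall>\<^sub>F q in at p. dist (fst q) r < \<delta>" using lim(1) \<delta>(1) by (rule tendstoD)
  moreover have "\<forall>\<^sub>F q in at p. dist (F r (snd q)) (F r x) < e / 2"
    using isCont_tendsto_compose[OF slice lim(2)] by (rule tendstoD) (use e in simp)
  moreover have "\<forall>\<^sub>F q in at p. w (snd q) < \<bar>w x\<bar> + 1"
    using isCont_tendsto_compose[OF w lim(2)] by (rule order_tendstoD) linarith
  ultimately have "\<forall>\<^sub>F q in at p. dist (F (fst q) (snd q)) (F (fst p) (snd p)) < e"
  proof eventually_elim
    case (elim q)
    have "dist (F (fst q) (snd q)) (F r (snd q)) \<le> \<epsilon> * w (snd q)" by (rule \<delta>(2)[OF elim(1)])
    also have "\<dots> \<le> \<epsilon> * (\<bar>w x\<bar> + 1)" using elim(3) \<epsilon>(1) by (intro mult_left_mono) auto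
    finally have "dist (F (fst q) (snd q)) (F r (snd q)) \<le> e / 2" by (simp add: \<epsilon>)
    with elim(2) show ?case
      using dist_triangle[of "F (fst q) (snd q)" "F r x" "F r (snd q)"] by (simp add: p)
  qed
  then show "\<forall>\<^sub>F q in at p within UNIV. dist (F (fst q) (snd q)) (F (fst p) (snd p)) < e" .
qed

lemma isCont_gradient:
  assumes "C1_holder_le \<alpha> A B f" "0 < \<alpha>"
  shows "isCont (gradient f) x"
  unfolding continuous_at
proof (rule tendsto_dist_iff[THEN iffD2])
  have "((\<lambda>y. dist y x) \<longlongrightarrow> 0) (at x)"
    using tendsto_dist_iff[of "\<lambda>y. y" x "at x"] by simp
  then have "((\<lambda>y. dist y x powr \<alpha>) \<longlongrightarrow> 0) (at x)"
    by (rule tendsto_zero_powrI[OF _ tendsto_const]) (use assms(2) in auto)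
  then have lim: "((\<lambda>y. B * dist y x powr \<alpha>) \<longlongrightarrow> 0) (at x)" by (rule tendsto_mult_right_zero)
  show "((\<lambda>y. dist (gradient f y) (gradient f x)) \<longlongrightarrow> 0) (at x)"
    by (rule tendsto_sandwich[OF _ _ tendsto_const lim]; intro always_eventually allI)
      (auto intro: C1_holder_leD(4)[OF assms(1)])
qed

lemma
  fixes g :: "real \<Rightarrow> 'a::euclidean_space \<Rightarrow> real"
  assumes \<alpha>: "0 < \<alpha>" and A: "A \<noteq> {}" and memb: "\<And>r. C1_holder_le \<alpha> A B (g r)"
    and unif: "\<And>\<epsilon>. 0 < \<epsilon> \<Longrightarrow> \<exists>\<delta>>0. \<forall>s r. dist s r < \<delta> \<longrightarrow> C1_holder_le \<alpha> A \<epsilon> (\<lambda>x. g s x - g r x)"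
  shows continuous_on_C1_holder: "continuous_on UNIV (\<lambda>p. g (fst p) (snd p))"
    and continuous_on_gradient_C1_holder: "continuous_on UNIV (\<lambda>p. gradient (g (fst p)) (snd p))"
proof -
  note M = C1_holder_leD[OF memb]
  show "continuous_on UNIV (\<lambda>p. gradient (g (fst p)) (snd p))"
  proof (rule continuous_on_pair_of_locally_uniform[where w = "\<lambda>_. 1"])
    show "isCont (gradient (g r)) x" for r x by (rule isCont_gradient[OF memb \<alpha>])
    show "\<exists>\<delta>>0. \<forall>s. dist s r < \<delta> \<longrightarrow> (\<forall>y. dist (gradient (g s) y) (gradient (g r) y) \<le> \<epsilon> * 1)"
      if "0 < \<epsilon>" for r \<epsilon>
    proof -
      obtain \<delta> where "0 < \<delta>" "\<And>s r. dist s r < \<delta> \<Longrightarrow> C1_holder_le \<alpha> A \<epsilon> (\<lambda>x. g s x - g r x)"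
        using unif[OF \<open>0 < \<epsilon>\<close>] by metis
      then have "norm (gradient (\<lambda>x. g s x - g r x) y) \<le> \<epsilon>" if "dist s r < \<delta>" for s y
        using that by (intro C1_holder_leD(3)) blast
      then show ?thesis
        using \<open>0 < \<delta>\<close> by (intro exI[of _ \<delta>]) (simp add: gradient_diff[OF M(1) M(1)] dist_norm)
    qed
  qed simp
  obtain z where z: "z \<in> A" using A by auto
  show "continuous_on UNIV (\<lambda>p. g (fst p) (snd p))"
  proof (rule continuous_on_pair_of_locally_uniform[where w = "\<lambda>y. 1 + norm (y - z)"])
    show "isCont (g r) x" for r x by (rule differentiable_imp_continuous_within[OF M(1)])
    show "\<exists>\<delta>>0. \<forall>s. dist s r < \<delta> \<longrightarrow> (\<forall>y. dist (g s y) (g r y) \<le> \<epsilon> * (1 + norm (y - z)))"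
      if "0 < \<epsilon>" for r \<epsilon>
    proof -
      obtain \<delta> where \<delta>: "0 < \<delta>" "\<And>s r. dist s r < \<delta> \<Longrightarrow> C1_holder_le \<alpha> A \<epsilon> (\<lambda>x. g s x - g r x)"
        using unif[OF \<open>0 < \<epsilon>\<close>] by metis
      have "dist (g s y) (g r y) \<le> \<epsilon> * (1 + norm (y - z))" if "dist s r < \<delta>" for s y
      proof -
        note L = C1_holder_leD[OF \<delta>(2)[OF that]]
        have "\<bar>(g s y - g r y) - (g s z - g r z)\<bar> \<le> \<epsilon> * norm (y - z)"
          by (rule dist_le_of_gradient_le) (rule L)+
        with L(2)[OF z] show ?thesis by (simp add: dist_real_def distrib_left)
      qed
      with \<delta>(1) show ?thesis by blast
    qed
  qed (intro continuous_intros)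
qed

section \<open>The heat potential\<close>

lemma integral_heat_measure_split:
  fixes f :: "real \<times> 'a::euclidean_space \<Rightarrow> real"
  assumes "a \<le> b" "b \<le> c"
    and int: "integrable (heat_measure a b) f" "integrable (heat_measure b c) f"
  shows "(\<integral>p. f p \<partial>heat_measure a c) = (\<integral>p. f p \<partial>heat_measure a b) + (\<integral>p. f p \<partial>heat_measure b c)"
proof -
  let ?w = "\<lambda>a b p. indicator {a<..b} (fst p) * heat_kernel (fst p) (snd p) :: real"
  have f [measurable]: "f \<in> borel_measurable (borel \<Otimes>\<^sub>M borel)"
    using borel_measurable_integrable[OF int(1)]
    by (simp add: measurable_cong_sets[OF sets_heat_measure refl])
  have eq: "(\<integral>p. f p \<partial>heat_measure a b) = (\<integral>p. ?w a b p *\<^sub>R f p \<partial>(lborel \<Otimes>\<^sub>M lborel))" for a b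
    unfolding heat_measure_def by (rule integral_density) (auto simp: heat_kernel_nonneg)
  have "integrable (lborel \<Otimes>\<^sub>M lborel) (\<lambda>p. ?w a b p *\<^sub>R f p)"
    if "integrable (heat_measure a b) f" for a b
    using that unfolding heat_measure_def
    by (subst (asm) integrable_density) (auto simp: heat_kernel_nonneg)
  note wint = this[OF int(1)] this[OF int(2)]
  have w: "?w a c p *\<^sub>R f p = ?w a b p *\<^sub>R f p + ?w b c p *\<^sub>R f p" for p
    using assms by (auto split: split_indicator)
  show ?thesis
    unfolding eq[of a c] w by (subst Bochner_Integration.integral_add) (use wint in \<open>auto simp: eq\<close>)
qed

text \<open>
  The substitution \<open>s = t + r\<close>.  The closed time interval becomes half-open because a single time
  is a null set.
\<close>

lemma heat_potential_eq_heat_average: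
  fixes g :: "real \<Rightarrow> 'a::euclidean_space \<Rightarrow> real"
  assumes meas: "(\<lambda>p. g (fst p) (snd p)) \<in> borel_measurable (borel \<Otimes>\<^sub>M borel)"
    and int: "integrable (heat_measure 0 (T - t)) (\<lambda>p. g (fst p) (x - snd p))"
    and gh: "\<And>r. 0 < r \<Longrightarrow> r \<le> T - t \<Longrightarrow> g r = h (t + r)"
  shows "heat_potential T h t x = heat_average 0 (T - t) g x"
proof -
  have "heat_potential T h t x
      = (\<integral>r. indicator {t..T} (t + r) *\<^sub>R heat_semigroup r (h (t + r)) x \<partial>lborel)"
    unfolding heat_potential_def set_lebesgue_integral_def
    by (subst lborel_integral_real_affine[where c = 1 and t = t]) simp_all
  also have "\<dots> = (\<integral>r. indicator {0<..T - t} r *\<^sub>R heat_semigroup r (g r) x \<partial>lborel)"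
    by (rule integral_discrete_difference[where X = "{0}"]) (auto simp: gh split: split_indicator)
  also have "\<dots> = heat_average 0 (T - t) g x"
    by (subst heat_average_eq_integral_heat_semigroup[OF meas int])
      (simp_all add: set_lebesgue_integral_def)
  finally show ?thesis .
qed

text \<open>
  The bound for a fixed time, and the modulus of continuity by the splitting of the time integral
  at \<open>T - t\<close> for \<open>s \<le> t\<close>.
\<close>

lemma C1_holder_le_heat_potential:
  fixes h :: "real \<Rightarrow> 'a::euclidean_space \<Rightarrow> real"
  assumes \<alpha>: "0 < \<alpha>" and A: "A \<noteq> {}" and T: "0 < T"
    and B: "\<And>t. t \<in> {0..T} \<Longrightarrow> C1_holder_le \<alpha> A B (h t)"
    and unif: "\<And>\<epsilon>. 0 < \<epsilon> \<Longrightarrow>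
      \<exists>\<delta>>0. \<forall>s\<in>{0..T}. \<forall>t\<in>{0..T}. dist s t < \<delta> \<longrightarrow> C1_holder_le \<alpha> A \<epsilon> (\<lambda>x. h s x - h t x)"
  defines "\<kappa> \<equiv> 1 + sqrt T * 2 powr (DIM('a) / 2)"
  shows "t \<in> {0..T} \<Longrightarrow> C1_holder_le \<alpha> A (\<kappa> * T * B) (heat_potential T h t)"
    and "0 < \<epsilon> \<Longrightarrow> \<exists>\<delta>>0. \<forall>s\<in>{0..T}. \<forall>t\<in>{0..T}. dist s t < \<delta> \<longrightarrow>
      C1_holder_le \<alpha> A \<epsilon> (\<lambda>x. heat_potential T h s x - heat_potential T h t x)"
proof -
  have \<kappa>: "1 \<le> \<kappa>" using T by (simp add: \<kappa>_def)
  have B0: "0 \<le> B" using C1_holder_leD(5)[OF B[of 0]] T by simp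
  \<comment> \<open>Freezing \<open>h\<close> outside \<open>[0, T]\<close> makes the shifted families continuous on all of space-time.\<close>
  define g where "g t r = h (max 0 (min T (t + r)))" for t r
  have clamp: "max 0 (min T u) \<in> {0..T}" "dist (max 0 (min T u)) (max 0 (min T v)) \<le> dist u v" for u v :: real
    using T by (auto simp: dist_real_def)
  have gB: "C1_holder_le \<alpha> A B (g t r)" for t r
    unfolding g_def by (intro B clamp)
  have g_unif: "\<exists>\<delta>>0. \<forall>s t r r'. dist (s + r) (t + r') < \<delta> \<longrightarrow>
      C1_holder_le \<alpha> A \<epsilon> (\<lambda>x. g s r x - g t r' x)" if "0 < \<epsilon>" for \<epsilon>
  proof -
    obtain \<delta> where "0 < \<delta>" "\<And>s t. s \<in> {0..T} \<Longrightarrow> t \<in> {0..T} \<Longrightarrow> dist s t < \<delta> \<Longrightarrow>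
        C1_holder_le \<alpha> A \<epsilon> (\<lambda>x. h s x - h t x)"
      using unif[OF \<open>0 < \<epsilon>\<close>] by blast
    then show ?thesis
      unfolding g_def by (intro exI[of _ \<delta>]) (blast intro: clamp le_less_trans[OF clamp(2)])
  qed
  have g_unif': "\<exists>\<delta>>0. \<forall>s r. dist s r < \<delta> \<longrightarrow> C1_holder_le \<alpha> A \<epsilon> (\<lambda>x. g t s x - g t r x)"
    if "0 < \<epsilon>" for t \<epsilon>
  proof -
    obtain \<delta> where "0 < \<delta>" "\<And>s r. dist (t + s) (t + r) < \<delta> \<Longrightarrow>
        C1_holder_le \<alpha> A \<epsilon> (\<lambda>x. g t s x - g t r x)"
      using g_unif[OF \<open>0 < \<epsilon>\<close>] by blast
    then show ?thesis by (intro exI[of _ \<delta>]) (simp add: dist_real_def)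
  qed
  have g_cont: "continuous_on UNIV (\<lambda>p. g t (fst p) (snd p))"
    and g_cont': "continuous_on UNIV (\<lambda>p. gradient (g t (fst p)) (snd p))" for t
    by (rule continuous_on_C1_holder[OF \<alpha> A gB g_unif'] continuous_on_gradient_C1_holder[OF \<alpha> A gB g_unif'];
      assumption)+
  note avg_le = C1_holder_le_heat_average[OF _ _ _ A g_cont g_cont' gB, where T = T, folded \<kappa>_def]
  note avg_int = integrable_heat_average[OF _ _ _ A g_cont g_cont' gB, where T = T]
  have pot: "heat_potential T h t = heat_average 0 (T - t) (g t)" if t: "t \<in> {0..T}" for t
  proof
    fix x
    show "heat_potential T h t x = heat_average 0 (T - t) (g t) x"
    proof (rule heat_potential_eq_heat_average)
      show "(\<lambda>p. g t (fst p) (snd p)) \<in> borel_measurable (borel \<Otimes>\<^sub>M borel)"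
        unfolding borel_prod by (rule borel_measurable_continuous_onI[OF g_cont])
      show "integrable (heat_measure 0 (T - t)) (\<lambda>p. g t (fst p) (x - snd p))"
        using t by (intro avg_int) auto
      show "g t r = h (t + r)" if "0 < r" "r \<le> T - t" for r
        using that t by (simp add: g_def)
    qed
  qed
  show "C1_holder_le \<alpha> A (\<kappa> * T * B) (heat_potential T h t)" if t: "t \<in> {0..T}"
    unfolding pot[OF t]
  proof (rule C1_holder_le_mono[OF avg_le])
    show "\<kappa> * (T - t - 0) * B \<le> \<kappa> * T * B"
      using t \<kappa> B0 by (intro mult_right_mono mult_left_mono) auto
  qed (use t in auto)
  show "\<exists>\<delta>>0. \<forall>s\<in>{0..T}. \<forall>t\<in>{0..T}. dist s t < \<delta> \<longrightarrow>
      C1_holder_le \<alpha> A \<epsilon> (\<lambda>x. heat_potential T h s x - heat_potential T h t x)" if \<epsilon>: "0 < \<epsilon>"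
  proof -
    \<comment> \<open>\<open>\<omega>\<close> bounds the increments of \<open>h\<close>; the smallness of \<open>\<delta>\<close> also controls the leftover time interval.\<close>
    define \<omega> where "\<omega> = \<epsilon> / (2 * \<kappa> * T)"
    have \<omega>: "0 < \<omega>" "\<kappa> * T * \<omega> = \<epsilon> / 2" using \<epsilon> \<kappa> T by (auto simp: \<omega>_def)
    obtain \<delta>1 where \<delta>1: "0 < \<delta>1" "\<And>s t r r'. dist (s + r) (t + r') < \<delta>1 \<Longrightarrow>
        C1_holder_le \<alpha> A \<omega> (\<lambda>x. g s r x - g t r' x)"
      using g_unif[OF \<omega>(1)] by blast
    define \<delta> where "\<delta> = min \<delta>1 (\<epsilon> / (2 * \<kappa> * (B + 1)))"
    have \<delta>: "0 < \<delta>" "\<delta> \<le> \<delta>1" "\<kappa> * \<delta> * B \<le> \<epsilon> / 2"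
    proof -
      show "0 < \<delta>" "\<delta> \<le> \<delta>1" using \<delta>1(1) \<epsilon> \<kappa> B0 by (auto simp: \<delta>_def)
      have \<kappa>_B: "\<kappa> \<noteq> 0" "B + 1 \<noteq> 0" using \<kappa> B0 by linarith+
      have cancel: "\<kappa> * (\<epsilon> / (2 * \<kappa> * b)) * b = \<epsilon> / 2" if "b \<noteq> 0" for b
        using that \<kappa>_B(1) by simp
      have "\<kappa> * \<delta> * B \<le> \<kappa> * (\<epsilon> / (2 * \<kappa> * (B + 1))) * (B + 1)"
        using \<kappa> B0 \<epsilon> \<open>0 < \<delta>\<close> by (intro mult_mono) (auto simp: \<delta>_def)
      also have "\<dots> = \<epsilon> / 2" using \<kappa>_B(2) by (rule cancel)
      finally show "\<kappa> * \<delta> * B \<le> \<epsilon> / 2" .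
    qed
    have main: "C1_holder_le \<alpha> A \<epsilon> (\<lambda>x. heat_potential T h s x - heat_potential T h t x)"
      if st: "s \<in> {0..T}" "t \<in> {0..T}" "s \<le> t" "dist s t < \<delta>" for s t
    proof -
      define d where "d r x = g s r x - g t r x" for r x
      have dB: "C1_holder_le \<alpha> A \<omega> (d r)" for r
        unfolding d_def using st(4) \<delta>(2) by (intro \<delta>1(2)) (simp add: dist_real_def)
      have d_cont: "continuous_on UNIV (\<lambda>p. d (fst p) (snd p))"
        unfolding d_def by (intro continuous_on_diff g_cont)
      have "gradient (d r) x = gradient (g s r) x - gradient (g t r) x" for r x
        unfolding d_def by (intro gradient_diff C1_holder_leD(1)[OF gB])
      then have d_cont': "continuous_on UNIV (\<lambda>p. gradient (d (fst p)) (snd p))"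
        by (simp add: continuous_on_diff g_cont')
      have 1: "C1_holder_le \<alpha> A (\<epsilon> / 2) (heat_average 0 (T - t) d)"
      proof (rule C1_holder_le_mono)
        show "C1_holder_le \<alpha> A (\<kappa> * (T - t - 0) * \<omega>) (heat_average 0 (T - t) d)"
          unfolding \<kappa>_def by (rule C1_holder_le_heat_average[OF _ _ _ A d_cont d_cont' dB]) (use st in auto)
        have "\<kappa> * (T - t - 0) * \<omega> \<le> \<kappa> * T * \<omega>"
          using st \<kappa> \<omega> by (intro mult_right_mono mult_left_mono) auto
        then show "\<kappa> * (T - t - 0) * \<omega> \<le> \<epsilon> / 2" using \<omega>(2) by simp
      qed
      have 2: "C1_holder_le \<alpha> A (\<epsilon> / 2) (heat_average (T - t) (T - s) (g s))"
      proof (rule C1_holder_le_mono[OF avg_le])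
        have "\<kappa> * (T - s - (T - t)) * B \<le> \<kappa> * \<delta> * B"
          using st \<kappa> B0 by (intro mult_right_mono mult_left_mono) (auto simp: dist_real_def)
        then show "\<kappa> * (T - s - (T - t)) * B \<le> \<epsilon> / 2" using \<delta>(3) by simp
      qed (use st in auto)
      have "heat_potential T h s x - heat_potential T h t x
          = heat_average 0 (T - t) d x + heat_average (T - t) (T - s) (g s) x" for x
      proof -
        have int: "integrable (heat_measure 0 (T - t)) (\<lambda>p. g u (fst p) (x - snd p))"
          "integrable (heat_measure (T - t) (T - s)) (\<lambda>p. g u (fst p) (x - snd p))" for u
          using st by (auto intro!: avg_int)
        have "heat_average 0 (T - s) (g s) x
            = heat_average 0 (T - t) (g s) x + heat_average (T - t) (T - s) (g s) x"
          unfolding heat_average_def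
          by (rule integral_heat_measure_split) (use st int in auto)
        moreover have "heat_average 0 (T - t) d x
            = heat_average 0 (T - t) (g s) x - heat_average 0 (T - t) (g t) x"
          unfolding heat_average_def d_def by (rule Bochner_Integration.integral_diff) (rule int)+
        ultimately show ?thesis unfolding pot[OF st(1)] pot[OF st(2)] by simp
      qed
      then show ?thesis using C1_holder_le_add[OF 1 2] by simp
    qed
    have "C1_holder_le \<alpha> A \<epsilon> (\<lambda>x. heat_potential T h s x - heat_potential T h t x)"
      if st: "s \<in> {0..T}" "t \<in> {0..T}" "dist s t < \<delta>" for s t
    proof (cases "s \<le> t")
      case False
      then have "C1_holder_le \<alpha> A \<epsilon> (\<lambda>x. heat_potential T h t x - heat_potential T h s x)"
        using st by (intro main) (auto simp: dist_commute)
      from C1_holder_le_uminus[OF this] show ?thesis by simp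
    qed (use st in \<open>auto intro: main\<close>)
    with \<delta>(1) show ?thesis by blast
  qed
qed

lemma (in C1_holder_norm) heat_potential_bounded:
  fixes h :: "real \<Rightarrow> 'a \<Rightarrow> real"
  assumes T: "0 < T" and h: "h \<in> CT T X N"
  shows "heat_potential T h \<in> CT T X N"
    and "CT_norm T N (heat_potential T h)
      \<le> C * ((1 + sqrt T * 2 powr (DIM('a) / 2)) * T) * CT_norm T N h"
proof -
  let ?\<kappa> = "1 + sqrt T * 2 powr (DIM('a) / 2)"
  let ?K = "CT_norm T N h"
  note hP = h[unfolded CT_iff]
  have hX: "h t \<in> X" if "t \<in> {0..T}" for t using h that by (simp add: CT_def)
  have "\<exists>B. \<forall>t\<in>{0..T}. C1_holder_le \<alpha> A B (h t)"
    using hP by (intro C1_holder_bounded) auto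
  then obtain B where B: "\<And>t. t \<in> {0..T} \<Longrightarrow> C1_holder_le \<alpha> A B (h t)" by blast
  have "N (h t) \<le> ?K" if "t \<in> {0..T}" for t
    unfolding CT_norm_def
  proof (rule cSUP_upper[OF that])
    show "bdd_above ((\<lambda>t. N (h t)) ` {0..T})"
      using norm_le[OF B] by (intro bdd_aboveI[of _ "C * B"]) auto
  qed
  then have K: "C1_holder_le \<alpha> A ?K (h t)" if "t \<in> {0..T}" for t
    using that by (intro C1_holder_le_mono[OF C1_holder_le_norm[OF hX]])
  have unif: "\<exists>\<delta>>0. \<forall>s\<in>{0..T}. \<forall>t\<in>{0..T}. dist s t < \<delta> \<longrightarrow> C1_holder_le \<alpha> A \<epsilon> (\<lambda>x. h s x - h t x)"
    if "0 < \<epsilon>" for \<epsilon>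
    using hP that by (intro C1_holder_uniformly_continuous) auto
  note pot = C1_holder_le_heat_potential[OF \<alpha>_pos nonempty T K unif]
  show "heat_potential T h \<in> CT T X N"
    unfolding CT_iff
  proof (intro conjI ballI allI impI)
    fix t assume t: "t \<in> {0..T}"
    show "\<exists>B. C1_holder_le \<alpha> A B (heat_potential T h t)" using pot(1)[OF _ _ t] by blast
    fix \<epsilon> :: real assume "0 < \<epsilon>"
    then obtain \<delta> where \<delta>: "0 < \<delta>" "\<And>s t. s \<in> {0..T} \<Longrightarrow> t \<in> {0..T} \<Longrightarrow> dist s t < \<delta> \<Longrightarrow>
        C1_holder_le \<alpha> A \<epsilon> (\<lambda>x. heat_potential T h s x - heat_potential T h t x)"
      using pot(2) by blast
    show "\<forall>\<^sub>F s in at t within {0..T}.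
        C1_holder_le \<alpha> A \<epsilon> (\<lambda>x. heat_potential T h s x - heat_potential T h t x)"
      unfolding eventually_at using \<delta> t by (intro exI[of _ \<delta>]) blast
  qed
  show "CT_norm T N (heat_potential T h) \<le> C * (?\<kappa> * T) * ?K"
    unfolding CT_norm_def[of T N "heat_potential T h"]
  proof (rule cSUP_least)
    show "N (heat_potential T h t) \<le> C * (?\<kappa> * T) * ?K" if "t \<in> {0..T}" for t
      using norm_le[OF pot(1)[OF _ _ that]] by (simp add: mult.assoc)
  qed (use T in auto)
qed

theorem lemma3p4:
  fixes \<alpha> T :: real
  assumes "0 < \<alpha>" and "\<alpha> < 1" and "0 < T"
  shows "\<exists>c::real.
    (\<forall>h :: real \<Rightarrow> 'a::euclidean_space \<Rightarrow> real.
       h \<in> CT T (holder_space (\<alpha> + 1)) (holder_norm (\<alpha> + 1)) \<longrightarrow>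
         heat_potential T h \<in> CT T (holder_space (\<alpha> + 1)) (holder_norm (\<alpha> + 1)) \<and>
         CT_norm T (holder_norm (\<alpha> + 1)) (heat_potential T h)
           \<le> c * CT_norm T (holder_norm (\<alpha> + 1)) h) \<and>
    (\<forall>h :: real \<Rightarrow> 'a \<Rightarrow> real.
       h \<in> CT T (D_holder_space \<alpha>) (D_holder_norm \<alpha>) \<longrightarrow>
         heat_potential T h \<in> CT T (D_holder_space \<alpha>) (D_holder_norm \<alpha>) \<and>
         CT_norm T (D_holder_norm \<alpha>) (heat_potential T h)
           \<le> c * CT_norm T (D_holder_norm \<alpha>) h)"
proof -
  interpret H: C1_holder_norm \<alpha> "UNIV :: 'a set" "holder_space (\<alpha> + 1)" "holder_norm (\<alpha> + 1)"
      "1 + 2 * DIM('a)"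
    using assms by (intro C1_holder_norm_holder_space)
  interpret D: C1_holder_norm \<alpha> "{0 :: 'a}" "D_holder_space \<alpha>" "D_holder_norm \<alpha>" "1 + 2 * DIM('a)"
  proof (intro C1_holder_norm_D_holder_space)
    have "1 \<le> DIM('a)" using DIM_positive[where 'a = 'a] by linarith
    then show "3 \<le> real (1 + 2 * DIM('a))" by linarith
  qed (use assms in auto)
  show ?thesis
    using H.heat_potential_bounded[OF \<open>0 < T\<close>] D.heat_potential_bounded[OF \<open>0 < T\<close>] by blast
qed

end
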